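(* Let $n\ge2$. For any convex body $K$ in $\mathbb{R}^n$ one has $$\omega_K=\varepsilon_K=\tilde\varepsilon_K,\qquad\text{where } \varepsilon_K:=\inf_{O\in\mathbb{R}^n}e_K(O),\quad \tilde\varepsilon_K:=\liminf_{O\to\infty}e_K(O).$$
   Context: A convex body in $\mathbb{R}^n$ is a compact convex set with nonempty interior. A supporting hyperplane of $K$ is an affine hyperplane that intersects $K$ but not its interior. For $u$ in the unit sphere $S^{n-1}$, $w_K(u)$ is the distance between the two supporting hyperplanes of $K$ orthogonal to $u$, and the thickness of $K$ is $\omega_K:=\min_{S^{n-1}}w_K$. For $O\in\mathbb{R}^n$, $e_K(O)$ is the maximal length of a chord $L\cap K$ of $K$ cut by a line $L$ through $O$. $O\to\infty$ means that the Euclidean norm of $O$ tends to infinity. *)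

theory Defs
  imports "HOL-Analysis.Analysis"
begin

definition convex_body :: "'a::euclidean_space set \<Rightarrow> bool" where
  "convex_body K \<longleftrightarrow> compact K \<and> convex K \<and> interior K \<noteq> {}"

definition hyperplane_orthogonal :: "'a::euclidean_space \<Rightarrow> 'a set \<Rightarrow> bool" where
  "hyperplane_orthogonal u H \<longleftrightarrow> u \<noteq> 0 \<and> (\<exists>c. H = {x. u \<bullet> x = c})"

definition supporting_hyperplane :: "'a::euclidean_space set \<Rightarrow> 'a set \<Rightarrow> bool" where
  "supporting_hyperplane K H \<longleftrightarrow>
     (\<exists>u. hyperplane_orthogonal u H) \<and> H \<inter> K \<noteq> {} \<and> H \<inter> interior K = {}"

(* A convex body has exactly two supporting hyperplanes orthogonal to a given unit vector,
   so the description below determines a unique number. *)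
definition width :: "'a::euclidean_space set \<Rightarrow> 'a \<Rightarrow> real" where
  "width K u = (THE d. \<exists>H1 H2. H1 \<noteq> H2
      \<and> supporting_hyperplane K H1 \<and> hyperplane_orthogonal u H1
      \<and> supporting_hyperplane K H2 \<and> hyperplane_orthogonal u H2
      \<and> d = setdist H1 H2)"

(* LEAST is the minimum of the set of widths; it is attained because the width is a
   continuous function on the compact sphere. *)
definition thickness :: "'a::euclidean_space set \<Rightarrow> real" where
  "thickness K = (LEAST w. w \<in> width K ` sphere 0 1)"

(* For compact convex K, a nonempty intersection with a line is a closed segment, possibly
   degenerate, and the length of the chord is the distance of its endpoints. *)
definition chord_lengths :: "'a::euclidean_space set \<Rightarrow> 'a \<Rightarrow> real set" where
  "chord_lengths K p =
     {dist a b | a b. \<exists>L. affine L \<and> aff_dim L = 1 \<and> p \<in> L \<and> L \<inter> K = closed_segment a b}"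

(* For a convex body the maximum is attained, since the length of the intersection with a line
   through p is upper semicontinuous in the direction of the line. *)
definition max_chord :: "'a::euclidean_space set \<Rightarrow> 'a \<Rightarrow> real" where
  "max_chord K p = (GREATEST l. l \<in> chord_lengths K p)"

definition inf_max_chord :: "'a::euclidean_space set \<Rightarrow> real" where
  "inf_max_chord K = (INF p. max_chord K p)"

(* Liminf requires a complete lattice, hence the extended reals; the filter at_infinity
   expresses that the norm of p tends to infinity. *)
definition liminf_max_chord :: "'a::euclidean_space set \<Rightarrow> ereal" where
  "liminf_max_chord K = Liminf at_infinity (\<lambda>p. ereal (max_chord K p))"

end

theory Submission
  imports Defs "HOL-Real_Asymp.Real_Asymp"
begin

text \<open>
  Through every point \<open>z\<close> there is a line containing points \<open>p, q\<close> of \<open>K\<close> that lie on two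
  parallel supporting hyperplanes, so the longest chord through \<open>z\<close> is at least the
  distance of these hyperplanes, hence at least the thickness. Take \<open>z = 0\<close>. If \<open>0\<close> is an
  interior point, let \<open>m\<close> be maximal with \<open>-m K \<subseteq> K\<close>: at a point \<open>q = -m p\<close> where \<open>-m K\<close>
  touches the boundary of \<open>K\<close>, a supporting hyperplane of \<open>K\<close> also supports \<open>-m K\<close>, which
  gives a parallel one at \<open>p\<close>. If \<open>0 \<notin> K\<close>, let \<open>m\<close> be maximal such that \<open>K\<close> meets \<open>m K\<close>, and
  separate \<open>K\<close> from the interior of \<open>m K\<close>. If \<open>0\<close> is a boundary point, support \<open>K\<close> at \<open>0\<close>.

  Conversely, let \<open>u\<close> be a direction of minimal width. Chords through \<open>t u\<close> become parallel
  to \<open>u\<close> as \<open>t \<rightarrow> \<infinity>\<close>, and they lie between the supporting hyperplanes orthogonal to \<open>u\<close>;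
  so the limit inferior is at most the thickness.
\<close>

section \<open>Linear functionals on a convex body, supporting hyperplanes and the width\<close>

lemma convex_body_extreme_points:
  fixes u :: "'a::euclidean_space"
  assumes "convex_body K"
  obtains p q where "p \<in> K" "q \<in> K" "\<And>x. x \<in> K \<Longrightarrow> u \<bullet> p \<le> u \<bullet> x" "\<And>x. x \<in> K \<Longrightarrow> u \<bullet> x \<le> u \<bullet> q"
proof -
  have K: "compact K" "K \<noteq> {}"
    using assms interior_subset by (auto simp: convex_body_def)
  have c: "continuous_on K (\<lambda>x. u \<bullet> x)" by (intro continuous_intros)
  show ?thesis
    using continuous_attains_inf[OF K c] continuous_attains_sup[OF K c] that by blast
qed

lemma interior_inner_less:
  fixes u :: "'a::euclidean_space"
  assumes "x \<in> interior K" "u \<noteq> 0" "\<And>y. y \<in> K \<Longrightarrow> u \<bullet> y \<le> c"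
  shows "u \<bullet> x < c"
proof -
  obtain e where e: "e > 0" "cball x e \<subseteq> K"
    using assms(1) by (auto simp: mem_interior_cball)
  \<comment> \<open>A shift of \<open>x\<close> by length \<open>e\<close> in direction
    \<open>u\<close> stays in \<open>K\<close> and strictly increases the functional.\<close>
  have "x + (e / norm u) *\<^sub>R u \<in> K"
    using e assms(2) by (intro subsetD[OF e(2)]) (simp add: dist_norm)
  from assms(3)[OF this] have "u \<bullet> x + (e / norm u) * (u \<bullet> u) \<le> c"
    by (simp add: inner_add_right)
  moreover have "(e / norm u) * (u \<bullet> u) > 0" using e assms(2) by simp
  ultimately show ?thesis by linarith
qed

text \<open>\<open>K\<close> lies in the closure of its interior, so interior points occur on both
  sides of level \<open>c\<close>; connectedness of the interior yields one on the level
  itself.\<close>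

lemma convex_body_inner_interior:
  fixes u :: "'a::euclidean_space"
  assumes "convex_body K" "p \<in> K" "q \<in> K" "u \<bullet> p < c" "c < u \<bullet> q"
  shows "\<exists>x \<in> interior K. u \<bullet> x = c"
proof -
  have cl: "K \<subseteq> closure (interior K)"
    using assms(1) by (simp add: convex_body_def convex_closure_interior closure_subset)
  have "open {x. u \<bullet> x < c}" "open {x. u \<bullet> x > c}"
    by (auto intro!: open_Collect_less continuous_intros)
  then obtain x y where xy: "x \<in> interior K" "u \<bullet> x < c" "y \<in> interior K" "u \<bullet> y > c"
    using cl assms(2-) open_Int_closure_eq_empty[of "{x. u \<bullet> x < c}" "interior K"]
      open_Int_closure_eq_empty[of "{x. u \<bullet> x > c}" "interior K"] by blast
  have "connected (interior K)"
    using assms(1) by (simp add: convex_body_def convex_connected convex_interior)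
  from connected_ivt_hyperplane[OF this xy(1,3), of u c] xy show ?thesis by auto
qed

text \<open>Levels strictly between the extreme values meet the interior, whereas a nonzero linear
  functional is never extremal at an interior point.\<close>

lemma supporting_hyperplane_levels:
  fixes u :: "'a::euclidean_space"
  assumes K: "convex_body K" and u: "u \<noteq> 0" and pq: "p \<in> K" "q \<in> K"
    and p: "\<And>x. x \<in> K \<Longrightarrow> u \<bullet> p \<le> u \<bullet> x" and q: "\<And>x. x \<in> K \<Longrightarrow> u \<bullet> x \<le> u \<bullet> q"
  shows "supporting_hyperplane K {x. u \<bullet> x = c} \<longleftrightarrow> c = u \<bullet> p \<or> c = u \<bullet> q"
proof
  assume "supporting_hyperplane K {x. u \<bullet> x = c}"
  then obtain x where x: "x \<in> K" "u \<bullet> x = c" and no: "\<And>y. y \<in> interior K \<Longrightarrow> u \<bullet> y \<noteq> c"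
    by (auto simp: supporting_hyperplane_def)
  have "\<not> (u \<bullet> p < c \<and> c < u \<bullet> q)"
    using convex_body_inner_interior[OF K pq, of u c] no by blast
  with p[OF x(1)] q[OF x(1)] x(2) show "c = u \<bullet> p \<or> c = u \<bullet> q" by linarith
next
  have "u \<bullet> x < u \<bullet> q" "u \<bullet> p < u \<bullet> x" if "x \<in> interior K" for x
    using interior_inner_less[OF that u q] interior_inner_less[OF that, of "-u" "- (u \<bullet> p)"] u p
    by auto
  then have "{x. u \<bullet> x = c} \<inter> interior K = {}" if "c = u \<bullet> p \<or> c = u \<bullet> q"
    using that by fastforce
  moreover assume c: "c = u \<bullet> p \<or> c = u \<bullet> q"
  moreover have "{x. u \<bullet> x = c} \<inter> K \<noteq> {}" using c pq by auto
  ultimately show "supporting_hyperplane K {x. u \<bullet> x = c}"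
    using u unfolding supporting_hyperplane_def hyperplane_orthogonal_def by blast
qed

lemma setdist_parallel_hyperplanes:
  fixes u :: "'a::euclidean_space"
  assumes "norm u = 1"
  shows "setdist {x. u \<bullet> x = c} {x. u \<bullet> x = d} = \<bar>c - d\<bar>"
proof -
  have uu: "u \<bullet> u = 1" using assms by (simp add: dot_square_norm)
  \<comment> \<open>The distance is attained on the common normal through the origin; Cauchy-Schwarz
    shows that no pair is closer.\<close>
  have "setdist {x. u \<bullet> x = c} {x. u \<bullet> x = d} = dist (c *\<^sub>R u) (d *\<^sub>R u)"
  proof (rule setdist_unique)
    fix x y assume "x \<in> {x. u \<bullet> x = c} \<and> y \<in> {x. u \<bullet> x = d}"
    then have "u \<bullet> (x - y) = c - d" by (simp add: inner_diff_right)
    with Cauchy_Schwarz_ineq2[of u "x - y"] assms show "dist (c *\<^sub>R u) (d *\<^sub>R u) \<le> dist x y"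
      by (simp add: dist_norm flip: scaleR_diff_left)
  qed (simp_all add: uu)
  then show ?thesis using assms by (simp add: dist_norm flip: scaleR_diff_left)
qed

text \<open>Replaces the definite description by maximum minus minimum of a linear functional, the
  form used in all later estimates.\<close>

lemma width_eq:
  fixes u :: "'a::euclidean_space"
  assumes K: "convex_body K" and u: "norm u = 1" and pq: "p \<in> K" "q \<in> K"
    and p: "\<And>x. x \<in> K \<Longrightarrow> u \<bullet> p \<le> u \<bullet> x" and q: "\<And>x. x \<in> K \<Longrightarrow> u \<bullet> x \<le> u \<bullet> q"
  shows "width K u = u \<bullet> (q - p)"
proof -
  have u0: "u \<noteq> 0" using u by auto
  \<comment> \<open>An interior point separates the two extreme levels, so the two hyperplanes are
    distinct.\<close>
  obtain z where z: "z \<in> interior K" using K by (auto simp: convex_body_def)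
  have "u \<bullet> z < u \<bullet> q" "u \<bullet> p \<le> u \<bullet> z"
    using interior_inner_less[OF z u0 q] p z interior_subset by auto
  then have lt: "u \<bullet> p < u \<bullet> q" by linarith
  have uq: "u \<bullet> u = 1" using u by (simp add: dot_square_norm)
  note supp = supporting_hyperplane_levels[OF K u0 pq p q]
  have orth: "hyperplane_orthogonal u {x. u \<bullet> x = c}" for c
    using u0 by (auto simp: hyperplane_orthogonal_def)
  have ne: "{x. u \<bullet> x = u \<bullet> p} \<noteq> {x. u \<bullet> x = u \<bullet> q}" using lt by force
  show ?thesis
    unfolding width_def
  proof (rule the_equality)
    have "supporting_hyperplane K {x. u \<bullet> x = u \<bullet> p}" "supporting_hyperplane K {x. u \<bullet> x = u \<bullet> q}"
      using supp by auto
    moreover have "u \<bullet> (q - p) = setdist {x. u \<bullet> x = u \<bullet> p} {x. u \<bullet> x = u \<bullet> q}"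
      using lt by (simp add: setdist_parallel_hyperplanes[OF u] inner_diff_right)
    ultimately have "{x. u \<bullet> x = u \<bullet> p} \<noteq> {x. u \<bullet> x = u \<bullet> q} \<and> supporting_hyperplane K {x. u \<bullet> x = u \<bullet> p}
      \<and> hyperplane_orthogonal u {x. u \<bullet> x = u \<bullet> p} \<and> supporting_hyperplane K {x. u \<bullet> x = u \<bullet> q}
      \<and> hyperplane_orthogonal u {x. u \<bullet> x = u \<bullet> q}
      \<and> u \<bullet> (q - p) = setdist {x. u \<bullet> x = u \<bullet> p} {x. u \<bullet> x = u \<bullet> q}"
      using ne orth by (intro conjI)
    then show "\<exists>H1 H2. H1 \<noteq> H2 \<and> supporting_hyperplane K H1 \<and> hyperplane_orthogonal u H1
      \<and> supporting_hyperplane K H2 \<and> hyperplane_orthogonal u H2 \<and> u \<bullet> (q - p) = setdist H1 H2"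
      by (rule exI[of _ "{x. u \<bullet> x = u \<bullet> p}", OF exI])
  next
    fix d
    assume "\<exists>H1 H2. H1 \<noteq> H2 \<and> supporting_hyperplane K H1 \<and> hyperplane_orthogonal u H1
      \<and> supporting_hyperplane K H2 \<and> hyperplane_orthogonal u H2 \<and> d = setdist H1 H2"
    then obtain H1 H2 where H: "H1 \<noteq> H2" "supporting_hyperplane K H1" "hyperplane_orthogonal u H1"
      "supporting_hyperplane K H2" "hyperplane_orthogonal u H2" "d = setdist H1 H2"
      by (elim exE conjE)
    then obtain c1 c2 where c: "H1 = {x. u \<bullet> x = c1}" "H2 = {x. u \<bullet> x = c2}"
      unfolding hyperplane_orthogonal_def by (elim conjE exE)
    with H have "c1 \<noteq> c2" "supporting_hyperplane K {x. u \<bullet> x = c1}"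
      "supporting_hyperplane K {x. u \<bullet> x = c2}" "d = setdist {x. u \<bullet> x = c1} {x. u \<bullet> x = c2}"
      by auto
    then show "d = u \<bullet> (q - p)"
      using supp[of c1] supp[of c2] lt
      by (auto simp: setdist_parallel_hyperplanes[OF u] inner_diff_right)
  qed
qed

section \<open>Dependence of the width on the direction, and its minimum\<close>

lemma inner_diff_le_width:
  fixes u :: "'a::euclidean_space"
  assumes "convex_body K" "norm u = 1" "x \<in> K" "y \<in> K"
  shows "\<bar>u \<bullet> (x - y)\<bar> \<le> width K u"
proof -
  obtain p q where pq: "p \<in> K" "q \<in> K" "\<And>x. x \<in> K \<Longrightarrow> u \<bullet> p \<le> u \<bullet> x" "\<And>x. x \<in> K \<Longrightarrow> u \<bullet> x \<le> u \<bullet> q"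
    using convex_body_extreme_points[OF assms(1)] by metis
  show ?thesis
    using width_eq[OF assms(1,2) pq] pq(3,4)[OF assms(3)] pq(3,4)[OF assms(4)]
    by (simp add: inner_diff_right)
qed

text \<open>The width at \<open>v\<close> is at least the increment of \<open>v\<close> along the
  extremal pair for \<open>u\<close>, so two widths differ by at most \<open>norm (u - v)\<close>
  times the diameter: the width is Lipschitz.\<close>

lemma continuous_on_width:
  fixes K :: "'a::euclidean_space set"
  assumes K: "convex_body K"
  shows "continuous_on (sphere 0 1) (width K)"
proof -
  have bd: "bounded K" using K by (simp add: convex_body_def compact_imp_bounded)
  have "width K u - width K v \<le> diameter K * dist u v" if "norm u = 1" "norm v = 1" for u v
  proof -
    obtain p q where pq: "p \<in> K" "q \<in> K" "\<And>x. x \<in> K \<Longrightarrow> u \<bullet> p \<le> u \<bullet> x" "\<And>x. x \<in> K \<Longrightarrow> u \<bullet> x \<le> u \<bullet> q"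
      using convex_body_extreme_points[OF K] by metis
    have "width K u - width K v \<le> u \<bullet> (q - p) - v \<bullet> (q - p)"
      using width_eq[OF K that(1) pq] inner_diff_le_width[OF K that(2) pq(2,1)] by linarith
    also have "\<dots> \<le> norm (u - v) * norm (q - p)"
      by (metis inner_diff_left norm_cauchy_schwarz)
    also have "\<dots> \<le> norm (u - v) * diameter K"
      using diameter_bounded_bound[OF bd pq(2,1)] by (simp add: dist_norm mult_left_mono)
    finally show ?thesis by (simp add: dist_norm mult.commute)
  qed
  then have "\<bar>width K u - width K v\<bar> \<le> diameter K * dist u v" if "norm u = 1" "norm v = 1" for u v
    using that by (smt (verit) dist_commute)
  then have "lipschitz_on (diameter K) (sphere 0 1) (width K)"
    by (intro lipschitz_onI) (auto simp: dist_real_def diameter_ge_0[OF bd])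
  then show ?thesis by (rule lipschitz_on_continuous_on)
qed

lemma thickness_attained:
  fixes K :: "'a::euclidean_space set"
  assumes K: "convex_body K"
  obtains u where "norm u = 1" "thickness K = width K u"
    "\<And>v. norm v = 1 \<Longrightarrow> width K u \<le> width K v"
proof -
  have "compact (sphere (0::'a) 1)" "sphere (0::'a) 1 \<noteq> {}"
    by auto
  then obtain u where u: "u \<in> sphere 0 1" "\<And>v. v \<in> sphere 0 1 \<Longrightarrow> width K u \<le> width K v"
    using continuous_attains_inf[OF _ _ continuous_on_width[OF K]] by metis
  have "thickness K = width K u"
    unfolding thickness_def using u by (intro Least_equality) auto
  with u that show ?thesis by simp
qed

section \<open>Chords through a point, described by collinear triples\<close>

lemma chord_length_imp_collinear:
  assumes "l \<in> chord_lengths K p"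
  obtains a b where "a \<in> K" "b \<in> K" "collinear {p, a, b}" "l = dist a b"
proof -
  from assms obtain a b L where L: "aff_dim L = 1" "p \<in> L" "L \<inter> K = closed_segment a b" "l = dist a b"
    unfolding chord_lengths_def by blast
  then have "a \<in> L \<inter> K" "b \<in> L \<inter> K" by auto
  moreover have "collinear L" using L(1) by (simp add: collinear_aff_dim)
  then have "collinear {p, a, b}"
    using \<open>a \<in> L \<inter> K\<close> \<open>b \<in> L \<inter> K\<close> L(2) by (blast intro: collinear_subset)
  ultimately show ?thesis using that L(4) by blast
qed

lemma ex_line_through_collinear:
  fixes a :: "'a::euclidean_space"
  assumes "collinear {p, a, b}"
  obtains L where "affine L" "aff_dim L = 1" "p \<in> L" "a \<in> L" "b \<in> L"
proof (cases "p = a \<and> p = b")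
  case True
  \<comment> \<open>Three coinciding points span no line, so an arbitrary direction is
    chosen.\<close>
  obtain e :: 'a where "e \<in> Basis" using nonempty_Basis by blast
  then have "p \<noteq> p + e" by auto
  then have "aff_dim (affine hull {p, p + e}) = 1" by simp
  moreover have "p \<in> affine hull {p, p + e}" by (simp add: hull_inc)
  ultimately show ?thesis
    using True that[of "affine hull {p, p + e}"] by (metis affine_affine_hull)
next
  case False
  have "aff_dim {p, a, b} \<le> 1" using assms by (simp add: collinear_aff_dim)
  moreover have "aff_dim {p, a, b} \<ge> 1"
    using False aff_dim_subset[of "{p, a}" "{p, a, b}"] aff_dim_subset[of "{p, b}" "{p, a, b}"]
    by (auto simp: aff_dim_2 split: if_splits)
  ultimately show ?thesis
    using that[of "affine hull {p, a, b}"] by (simp add: hull_inc)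
qed

text \<open>The line meets \<open>K\<close> in a compact convex collinear set, which is a segment;
  two of its points are at most as far apart as its ends.\<close>

lemma collinear_le_chord_length:
  fixes K :: "'a::euclidean_space set"
  assumes K: "convex_body K" and ab: "a \<in> K" "b \<in> K" "collinear {p, a, b}"
  shows "\<exists>l \<in> chord_lengths K p. dist a b \<le> l"
proof -
  obtain L where L: "affine L" "aff_dim L = 1" "p \<in> L" "a \<in> L" "b \<in> L"
    using ex_line_through_collinear[OF ab(3)] by blast
  have "collinear (L \<inter> K)"
    using L(2) collinear_subset[of L] by (simp add: collinear_aff_dim)
  moreover have "compact (L \<inter> K)" "convex (L \<inter> K)"
    using K L(1) by (auto simp: convex_body_def affine_closed closed_Int_compact affine_imp_convex convex_Int)
  ultimately obtain c d where cd: "L \<inter> K = closed_segment c d"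
    using compact_convex_collinear_segment[of "L \<inter> K"] L ab by blast
  then have "dist c d \<in> chord_lengths K p"
    using L unfolding chord_lengths_def by blast
  moreover have "a \<in> closed_segment c d" "b \<in> closed_segment c d" using cd L ab by auto
  then obtain s t where st: "a = (1 - s) *\<^sub>R c + s *\<^sub>R d" "0 \<le> s" "s \<le> 1"
    "b = (1 - t) *\<^sub>R c + t *\<^sub>R d" "0 \<le> t" "t \<le> 1"
    by (auto simp: in_segment)
  then have "a - b = (t - s) *\<^sub>R (c - d)" by (simp only: st(1,4)) (simp add: algebra_simps)
  then have "dist a b = \<bar>t - s\<bar> * dist c d" by (simp add: dist_norm)
  then have "dist a b \<le> dist c d" using st by (simp add: mult_left_le_one_le)
  ultimately show ?thesis by blast
qed

text \<open>Maximising over pairs of points of \<open>K\<close> collinear with \<open>p\<close>,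
  instead of over lines, gives a continuous function on a compact set. A maximal pair must span a
  full chord, since the chord containing it is at least as long.\<close>

lemma max_chord_attained:
  fixes K :: "'a::euclidean_space set"
  assumes K: "convex_body K"
  obtains a b where "a \<in> K" "b \<in> K" "collinear {p, a, b}" "max_chord K p = dist a b"
    "\<And>x y. x \<in> K \<Longrightarrow> y \<in> K \<Longrightarrow> collinear {p, x, y} \<Longrightarrow> dist x y \<le> max_chord K p"
proof -
  define S where "S = {z \<in> K \<times> K. collinear {p, fst z, snd z}}"
  \<comment> \<open>The equality case of Cauchy-Schwarz expresses collinearity by a continuous
    equation, hence a closed condition.\<close>
  have "collinear {p, a, b} \<longleftrightarrow> \<bar>(p - a) \<bullet> (b - a)\<bar> = norm (p - a) * norm (b - a)" for a b
    by (simp add: norm_cauchy_schwarz_equal collinear_3[of p a b, unfolded NO_MATCH_def])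
  then have S: "S = (K \<times> K) \<inter> {z. \<bar>(p - fst z) \<bullet> (snd z - fst z)\<bar> = norm (p - fst z) * norm (snd z - fst z)}"
    by (auto simp: S_def)
  have "compact S"
    unfolding S using K
    by (intro compact_Int_closed compact_Times closed_Collect_eq continuous_intros) (auto simp: convex_body_def)
  moreover obtain k where "k \<in> K" using K interior_subset by (force simp: convex_body_def)
  then have "(k, k) \<in> S" by (simp add: S_def)
  then have "S \<noteq> {}" by blast
  moreover have "continuous_on S (\<lambda>z. dist (fst z) (snd z))" by (intro continuous_intros)
  ultimately obtain z where z: "z \<in> S" "\<And>y. y \<in> S \<Longrightarrow> dist (fst y) (snd y) \<le> dist (fst z) (snd z)"
    using continuous_attains_sup[of S "\<lambda>z. dist (fst z) (snd z)"] by metis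
  obtain a b where zab: "z = (a, b)" by (cases z)
  have ab: "a \<in> K" "b \<in> K" "collinear {p, a, b}" using z(1) by (auto simp: S_def zab)
  have mx: "dist x y \<le> dist a b" if "x \<in> K" "y \<in> K" "collinear {p, x, y}" for x y
    using z(2)[of "(x, y)"] that by (simp add: S_def zab)
  have le: "l \<le> dist a b" if "l \<in> chord_lengths K p" for l
    using chord_length_imp_collinear[OF that] mx by metis
  with collinear_le_chord_length[OF K ab] have "dist a b \<in> chord_lengths K p"
    by (metis order_antisym)
  then have "max_chord K p = dist a b"
    unfolding max_chord_def using le by (intro Greatest_equality) auto
  with that ab mx show ?thesis by metis
qed


section \<open>Parallel supporting hyperplanes at points collinear with a given point\<close>

lemma parallel_supports_inside:
  fixes K :: "'a::euclidean_space set"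
  assumes K: "convex_body K" and 0: "0 \<in> interior K"
  obtains p q u where "p \<in> K" "q \<in> K" "collinear {0, p, q}" "u \<noteq> 0"
    "\<And>x. x \<in> K \<Longrightarrow> u \<bullet> p \<le> u \<bullet> x" "\<And>x. x \<in> K \<Longrightarrow> u \<bullet> x \<le> u \<bullet> q"
proof -
  have cK: "compact K" "convex K" "closed K" using K by (auto simp: convex_body_def compact_imp_closed)
  obtain R where R: "R > 0" "\<And>x. x \<in> K \<Longrightarrow> norm x \<le> R"
    using compact_imp_bounded[OF cK(1)] by (metis bounded_pos)
  obtain e where e: "e > 0" "cball 0 e \<subseteq> K" using 0 by (auto simp: mem_interior_cball)
  obtain b :: 'a where b: "b \<in> Basis" using nonempty_Basis by blast
  define S where "S = {m. 0 \<le> m \<and> (\<forall>x\<in>K. (- m) *\<^sub>R x \<in> K)}"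
  have "S = {0..} \<inter> (\<Inter>x\<in>K. (\<lambda>m. (- m) *\<^sub>R x) -` K)" by (auto simp: S_def)
  moreover have "closed ((\<lambda>m. (- m) *\<^sub>R x) -` K)" for x
    by (intro closed_vimage cK continuous_intros)
  ultimately have "closed S" by (simp add: closed_Int closed_INT)
  \<comment> \<open>\<open>K\<close> contains a vector of norm \<open>e\<close>, and its image under
    scaling by \<open>-m\<close> has norm at most \<open>R\<close>.\<close>
  moreover have "m \<in> {0..R / e}" if "m \<in> S" for m
  proof -
    have "e *\<^sub>R b \<in> K" using e b by (intro subsetD[OF e(2)]) simp
    then have "norm ((- m) *\<^sub>R e *\<^sub>R b) \<le> R" using that R(2) unfolding S_def by blast
    then show ?thesis using that e b by (simp add: S_def pos_le_divide_eq)
  qed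
  then have "bounded S" by (intro bounded_subset[OF bounded_closed_interval[of 0 "R / e"]] subsetI)
  moreover have "0 \<in> S" using 0 interior_subset by (auto simp: S_def)
  ultimately obtain m where m: "m \<in> S" "\<And>t. t \<in> S \<Longrightarrow> t \<le> m"
    using compact_attains_sup[of S] by (auto simp: compact_eq_bounded_closed)
  \<comment> \<open>If the scaled copy lay in the interior, compactness would leave a uniform margin
    \<open>d\<close>. Raising \<open>m\<close> by \<open>d / (2 * R)\<close> moves each point by at
    most \<open>d / 2\<close>, contradicting maximality.\<close>
  have "\<exists>p\<in>K. (- m) *\<^sub>R p \<notin> interior K"
  proof (rule ccontr)
    assume "\<not> ?thesis"
    then have "(\<lambda>x. (- m) *\<^sub>R x) ` K \<subseteq> interior K" by auto
    then obtain d where d: "d > 0" "(\<Union>x\<in>(\<lambda>x. (- m) *\<^sub>R x) ` K. ball x d) \<subseteq> interior K"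
      using compact_subset_open_imp_ball_epsilon_subset[OF compact_scaling[OF cK(1)] open_interior] by metis
    have "(- (m + d / (2 * R))) *\<^sub>R x \<in> K" if "x \<in> K" for x
    proof -
      have "d * norm x < 2 * R * d"
        using R(1) R(2)[OF that] d(1) by (simp add: mult.commute[of _ d])
      moreover have "(- m) *\<^sub>R x - (- (m + d / (2 * R))) *\<^sub>R x = (d / (2 * R)) *\<^sub>R x"
        by (simp add: algebra_simps)
      ultimately have "(- (m + d / (2 * R))) *\<^sub>R x \<in> ball ((- m) *\<^sub>R x) d"
        using R(1) d(1) by (simp add: dist_norm pos_divide_less_eq mult.commute)
      then show ?thesis using d(2) that interior_subset by blast
    qed
    moreover have "0 \<le> m + d / (2 * R)" using m(1) d R by (simp add: S_def)
    ultimately have "m + d / (2 * R) \<in> S" unfolding S_def by blast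
    then have "m + d / (2 * R) \<le> m" by (rule m(2))
    moreover have "d / (2 * R) > 0" using d(1) R(1) by simp
    ultimately show False by linarith
  qed
  then obtain p where p: "p \<in> K" "(- m) *\<^sub>R p \<notin> interior K" by blast
  have q: "(- m) *\<^sub>R p \<in> K" using m p unfolding S_def by blast
  \<comment> \<open>For \<open>m = 0\<close> the touching point would be \<open>0\<close>, which is
    interior.\<close>
  have "m \<noteq> 0" using p 0 by auto
  then have m0: "m > 0" using m by (simp add: S_def)
  have "rel_interior K = interior K" using 0 by (intro rel_interior_nonempty_interior) auto
  with p(2) have "(- m) *\<^sub>R p \<notin> rel_interior K" by simp
  then obtain a where a: "a \<noteq> 0" "\<And>y. y \<in> K \<Longrightarrow> a \<bullet> ((- m) *\<^sub>R p) \<le> a \<bullet> y"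
    by (rule supporting_hyperplane_rel_boundary[OF cK(2) q]) simp
  show ?thesis
  proof (rule that[OF p(1) q, of "- a"])
    show "collinear {0, p, (- m) *\<^sub>R p}" unfolding collinear_lemma by blast
    show "- a \<noteq> 0" using a by simp
    fix x assume x: "x \<in> K"
    show "- a \<bullet> x \<le> - a \<bullet> ((- m) *\<^sub>R p)" using a(2)[OF x] by simp
    \<comment> \<open>The support inequality at \<open>(- m) *\<^sub>R p\<close>, applied to this
      point of \<open>K\<close> and divided by \<open>-m\<close>, reverses into the opposite
      inequality at \<open>p\<close>.\<close>
    have "(- m) *\<^sub>R x \<in> K" using x m(1) unfolding S_def by blast
    from a(2)[OF this] m0 show "- a \<bullet> p \<le> - a \<bullet> x" by simp
  qed
qed

lemma parallel_supports_outside: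
  fixes K :: "'a::euclidean_space set"
  assumes K: "convex_body K" and 0: "0 \<notin> K"
  obtains p q u where "p \<in> K" "q \<in> K" "collinear {0, p, q}" "u \<noteq> 0"
    "\<And>x. x \<in> K \<Longrightarrow> u \<bullet> p \<le> u \<bullet> x" "\<And>x. x \<in> K \<Longrightarrow> u \<bullet> x \<le> u \<bullet> q"
proof -
  have cK: "compact K" "convex K" "interior K \<noteq> {}" using K by (auto simp: convex_body_def)
  then have K0: "K \<noteq> {}" using interior_subset by blast
  \<comment> \<open>Equality in Cauchy-Schwarz without absolute value selects pairs on a common ray
    from \<open>0\<close>; the largest ratio of their norms is the maximal scaling factor.\<close>
  define S where "S = (K \<times> K) \<inter> {z. fst z \<bullet> snd z = norm (fst z) * norm (snd z)}"
  have "compact S"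
    unfolding S_def
    by (intro compact_Int_closed compact_Times cK closed_Collect_eq continuous_intros)
  moreover have "(k, k) \<in> S" if "k \<in> K" for k
    using that by (simp add: S_def power2_norm_eq_inner flip: power2_eq_square)
  then have "S \<noteq> {}" using K0 by blast
  moreover have "continuous_on S (\<lambda>z. norm (snd z) / norm (fst z))"
    using 0 by (intro continuous_intros) (auto simp: S_def)
  ultimately obtain z where z: "z \<in> S"
    "\<And>y. y \<in> S \<Longrightarrow> norm (snd y) / norm (fst y) \<le> norm (snd z) / norm (fst z)"
    using continuous_attains_sup[of S "\<lambda>z. norm (snd z) / norm (fst z)"] by metis
  obtain p q where zpq: "z = (p, q)" by (cases z)
  have pq: "p \<in> K" "q \<in> K" "p \<bullet> q = norm p * norm q" using z(1) by (auto simp: S_def zpq)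
  have n0: "p \<noteq> 0" "q \<noteq> 0" using pq 0 by auto
  define m where "m = norm q / norm p"
  have m0: "m > 0" using n0 by (simp add: m_def)
  have qm: "q = m *\<^sub>R p"
  proof -
    have "norm p *\<^sub>R q = norm q *\<^sub>R p" using pq(3) norm_cauchy_schwarz_eq by metis
    then have "(inverse (norm p)) *\<^sub>R norm p *\<^sub>R q = inverse (norm p) *\<^sub>R norm q *\<^sub>R p" by simp
    then show ?thesis using n0 by (simp add: m_def divide_inverse mult.commute)
  qed
  have mx: "t \<le> m" if "x \<in> K" "t *\<^sub>R x \<in> K" "t > 0" for x t
  proof -
    have "(x, t *\<^sub>R x) \<in> S"
      using that by (simp add: S_def power2_norm_eq_inner flip: power2_eq_square)
    moreover have "x \<noteq> 0" using that 0 by auto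
    ultimately show ?thesis using z(2)[of "(x, t *\<^sub>R x)"] that by (simp add: zpq m_def)
  qed
  have disj: "K \<inter> (\<lambda>x. m *\<^sub>R x) ` interior K = {}"
  proof (rule ccontr)
    assume "\<not> ?thesis"
    then obtain y where y: "y \<in> interior K" "m *\<^sub>R y \<in> K" by auto
    obtain e where e: "e > 0" "cball y e \<subseteq> K" using y(1) by (auto simp: mem_interior_cball)
    have y0: "y \<noteq> 0" using y(1) 0 interior_subset by blast
    \<comment> \<open>The first bound keeps \<open>1 - d\<close> positive, the second keeps
      \<open>(1 - d) *\<^sub>R y\<close> in \<open>K\<close>. Shrinking \<open>y\<close> this way
      raises the scaling factor to \<open>m / (1 - d)\<close>, beyond the maximum.\<close>
    define d where "d = min (1/2) (e / norm y)"
    have d: "0 < d" "d < 1" "d * norm y \<le> e"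
      using e y0 by (auto simp: d_def min_def field_simps)
    have "y - d *\<^sub>R y \<in> K" using d by (intro subsetD[OF e(2)]) (simp add: dist_norm)
    then have "(1 - d) *\<^sub>R y \<in> K" by (simp add: algebra_simps)
    moreover have "(m / (1 - d)) *\<^sub>R (1 - d) *\<^sub>R y \<in> K" using y(2) d by simp
    ultimately have "m / (1 - d) \<le> m" using mx d m0 by simp
    then have "d * m \<le> 0" using d by (simp add: field_simps)
    then show False using mult_pos_pos[OF d(1) m0] by linarith
  qed
  have "convex ((\<lambda>x. m *\<^sub>R x) ` interior K)"
    using cK(2) by (intro convex_scaling convex_interior)
  then obtain a b where ab: "a \<noteq> 0" "\<And>x. x \<in> K \<Longrightarrow> a \<bullet> x \<le> b"
    "\<And>x. x \<in> interior K \<Longrightarrow> b \<le> a \<bullet> (m *\<^sub>R x)"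
    using separating_hyperplane_sets[OF cK(2) _ K0 _ disj] cK(3) by auto
  have "closed {x. b \<le> a \<bullet> (m *\<^sub>R x)}" by (intro closed_Collect_le continuous_intros)
  then have "closure (interior K) \<subseteq> {x. b \<le> a \<bullet> (m *\<^sub>R x)}"
    using ab(3) by (intro closure_minimal) auto
  then have abK: "b \<le> m * (a \<bullet> x)" if "x \<in> K" for x
    using that convex_closure_interior[OF cK(2,3)] closure_subset[of K] by auto
  \<comment> \<open>The point \<open>q = m *\<^sub>R p\<close> lies in both separated sets up to
    closure, so it lies on the separating hyperplane.\<close>
  have "b = m * (a \<bullet> p)" using abK[OF pq(1)] ab(2)[OF pq(2)] qm by simp
  show ?thesis
  proof (rule that[OF pq(1,2) _ ab(1)])
    show "collinear {0, p, q}" by (auto simp: collinear_lemma qm)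
    fix x assume x: "x \<in> K"
    show "a \<bullet> x \<le> a \<bullet> q" using ab(2)[OF x] \<open>b = _\<close> qm by simp
    show "a \<bullet> p \<le> a \<bullet> x" using abK[OF x] \<open>b = _\<close> m0 by simp
  qed
qed

lemma parallel_supports_through_0:
  fixes K :: "'a::euclidean_space set"
  assumes K: "convex_body K"
  obtains p q u where "p \<in> K" "q \<in> K" "collinear {0, p, q}" "u \<noteq> 0"
    "\<And>x. x \<in> K \<Longrightarrow> u \<bullet> p \<le> u \<bullet> x" "\<And>x. x \<in> K \<Longrightarrow> u \<bullet> x \<le> u \<bullet> q"
proof -
  consider "0 \<in> interior K" | "0 \<notin> K" | "0 \<in> K" "0 \<notin> interior K" by blast
  then show ?thesis
  proof cases
    case 1
    then show ?thesis using parallel_supports_inside[OF K] that by metis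
  next
    case 2
    then show ?thesis using parallel_supports_outside[OF K] that by metis
  next
    case 3
    \<comment> \<open>Here \<open>p = 0\<close> itself serves as one contact point, and collinearity
      with \<open>0\<close> is automatic for any \<open>q\<close>.\<close>
    have "convex K" "rel_interior K = interior K"
      using K by (auto simp: convex_body_def rel_interior_nonempty_interior)
    then obtain a where a: "a \<noteq> 0" "\<And>y. y \<in> K \<Longrightarrow> a \<bullet> 0 \<le> a \<bullet> y"
      using supporting_hyperplane_rel_boundary[of K 0] 3 by metis
    obtain q where q: "q \<in> K" "\<And>x. x \<in> K \<Longrightarrow> a \<bullet> x \<le> a \<bullet> q"
      using convex_body_extreme_points[OF K] by metis
    show ?thesis using that[OF 3(1) q(1) _ a(1)] a(2) q(2) by simp
  qed
qed

text \<open>Translation moves \<open>z\<close> to the origin, and \<open>sgn u\<close> normalises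
  the normal vector.\<close>

lemma parallel_supports_through_point:
  fixes K :: "'a::euclidean_space set"
  assumes K: "convex_body K"
  obtains p q u where "p \<in> K" "q \<in> K" "collinear {z, p, q}" "norm u = 1"
    "\<And>x. x \<in> K \<Longrightarrow> u \<bullet> p \<le> u \<bullet> x" "\<And>x. x \<in> K \<Longrightarrow> u \<bullet> x \<le> u \<bullet> q"
proof -
  have "convex_body ((\<lambda>x. x - z) ` K)"
    using K by (simp add: convex_body_def compact_translation_subtract interior_translation_subtract)
  then obtain p q u where *: "p \<in> K" "q \<in> K" "collinear {0, p - z, q - z}" "u \<noteq> 0"
    "\<And>x. x \<in> K \<Longrightarrow> u \<bullet> (p - z) \<le> u \<bullet> (x - z)" "\<And>x. x \<in> K \<Longrightarrow> u \<bullet> (x - z) \<le> u \<bullet> (q - z)"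
    by (elim parallel_supports_through_0) blast
  have "collinear {p, z, q}"
    using *(3) collinear_3[of p z q] by (simp add: collinear_3[of p z q, unfolded NO_MATCH_def])
  then have "collinear {z, p, q}" by (simp add: insert_commute)
  moreover have "norm (sgn u) = 1" using *(4) by (simp add: norm_sgn)
  moreover have "sgn u \<bullet> p \<le> sgn u \<bullet> x" "sgn u \<bullet> x \<le> sgn u \<bullet> q" if "x \<in> K" for x
    using *(5,6)[OF that] *(4) by (auto simp: sgn_div_norm inner_diff_right divide_right_mono)
  ultimately show ?thesis using that * by blast
qed

section \<open>Comparison of the thickness with longest chords, from below everywhere and from above
  far away\<close>

lemma thickness_le_max_chord:
  fixes K :: "'a::euclidean_space set"
  assumes K: "convex_body K"
  shows "thickness K \<le> max_chord K p"
proof -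
  obtain a b u where *: "a \<in> K" "b \<in> K" "collinear {p, a, b}" "norm u = 1"
    "\<And>x. x \<in> K \<Longrightarrow> u \<bullet> a \<le> u \<bullet> x" "\<And>x. x \<in> K \<Longrightarrow> u \<bullet> x \<le> u \<bullet> b"
    using parallel_supports_through_point[OF K] by metis
  have "thickness K \<le> width K u" using thickness_attained[OF K] *(4) by metis
  also have "\<dots> = u \<bullet> (b - a)" using width_eq[OF K] * by metis
  also have "\<dots> \<le> dist a b"
    using norm_cauchy_schwarz[of u "b - a"] *(4) by (simp add: dist_norm norm_minus_commute)
  also have "\<dots> \<le> max_chord K p" using max_chord_attained[OF K, of p] *(1-3) by metis
  finally show ?thesis .
qed

text \<open>Along a line, increments of a linear functional are proportional to distances; the
  cross-multiplied form also covers \<open>p = a\<close>.\<close>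

lemma collinear_inner_dist:
  fixes u :: "'a::euclidean_space"
  assumes "collinear {p, a, b}"
  shows "\<bar>u \<bullet> (p - a)\<bar> * dist a b = \<bar>u \<bullet> (b - a)\<bar> * dist p a"
proof (cases "p = a")
  case False
  with assms obtain c where "b - a = c *\<^sub>R (p - a)"
    using collinear_lemma[of "p - a" "b - a"] by (auto simp: collinear_3[of p a b, unfolded NO_MATCH_def])
  then show ?thesis by (simp add: dist_norm norm_minus_commute[of a b] abs_mult)
qed auto

text \<open>The vector from \<open>a\<close> to the far point has length at most
  \<open>t + R\<close> and component along \<open>u\<close> at least \<open>t - R\<close>. The chord
  has the same slope, while its component along \<open>u\<close> is at most the width.\<close>

lemma max_chord_far_le:
  fixes K :: "'a::euclidean_space set"
  assumes K: "convex_body K" and u: "norm u = 1" and R: "\<And>x. x \<in> K \<Longrightarrow> norm x \<le> R" and t: "R < t"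
  shows "max_chord K (t *\<^sub>R u) \<le> width K u * ((t + R) / (t - R))"
proof -
  define p where "p = t *\<^sub>R u"
  obtain a b where ab: "a \<in> K" "b \<in> K" "collinear {p, a, b}" "max_chord K p = dist a b"
    using max_chord_attained[OF K, of p] by metis
  have uu: "u \<bullet> u = 1" using u by (simp add: dot_square_norm)
  have "u \<bullet> a \<le> R" using norm_cauchy_schwarz[of u a] u R[OF ab(1)] by simp
  then have "t - R \<le> \<bar>u \<bullet> (p - a)\<bar>" by (simp add: p_def inner_diff_right uu)
  then have "(t - R) * dist a b \<le> \<bar>u \<bullet> (p - a)\<bar> * dist a b" by (intro mult_right_mono) auto
  also have "\<dots> = \<bar>u \<bullet> (b - a)\<bar> * dist p a" by (rule collinear_inner_dist[OF ab(3)])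
  also have "\<dots> \<le> width K u * (t + R)"
  proof (intro mult_mono)
    show "\<bar>u \<bullet> (b - a)\<bar> \<le> width K u" by (rule inner_diff_le_width[OF K u ab(2,1)])
    then show "0 \<le> width K u" by linarith
    have "0 \<le> R" using R[OF ab(1)] norm_ge_zero order_trans by blast
    then show "dist p a \<le> t + R"
      using norm_triangle_ineq4[of p a] R[OF ab(1)] t u by (simp add: p_def dist_norm)
  qed auto
  finally show ?thesis using t ab(4) by (simp add: p_def pos_le_divide_eq mult.commute)
qed

text \<open>Any \<open>y\<close> below the limit inferior is eventually a lower bound along the ray
  spanned by a direction of minimal width; there the factor \<open>(t + R) / (t - R)\<close> tends
  to 1.\<close>

lemma liminf_max_chord_le:
  fixes K :: "'a::euclidean_space set"
  assumes K: "convex_body K"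
  shows "liminf_max_chord K \<le> ereal (thickness K)"
proof (rule dense_le)
  fix y assume "y < liminf_max_chord K"
  then have y: "eventually (\<lambda>p. y < ereal (max_chord K p)) at_infinity"
    unfolding liminf_max_chord_def by (rule less_LiminfD)
  obtain u where u: "norm u = 1" "thickness K = width K u" using thickness_attained[OF K] by metis
  obtain R where R: "\<And>x. x \<in> K \<Longrightarrow> norm x \<le> R"
    using K unfolding convex_body_def by (metis compact_imp_bounded bounded_iff)
  have "filterlim (\<lambda>t. norm (t *\<^sub>R u)) at_top at_top"
    using u by (simp add: filterlim_abs_real)
  then have "filterlim (\<lambda>t. t *\<^sub>R u) at_infinity at_top"
    by (rule filterlim_norm_at_top_imp_at_infinity)
  then have "eventually (\<lambda>t. y < ereal (max_chord K (t *\<^sub>R u))) at_top"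
    using y unfolding filterlim_iff by blast
  then have ev: "eventually (\<lambda>t. y \<le> ereal (thickness K * ((t + R) / (t - R)))) at_top"
    using eventually_gt_at_top[of R]
  proof eventually_elim
    case (elim t)
    have "max_chord K (t *\<^sub>R u) \<le> thickness K * ((t + R) / (t - R))"
      using max_chord_far_le[OF K u(1) R elim(2)] u(2) by simp
    then have "ereal (max_chord K (t *\<^sub>R u)) \<le> ereal (thickness K * ((t + R) / (t - R)))"
      by simp
    with elim(1) show ?case by order
  qed
  have "((\<lambda>t. (t + R) / (t - R)) \<longlongrightarrow> 1) at_top" by real_asymp
  then have "((\<lambda>t. ereal (thickness K * ((t + R) / (t - R)))) \<longlongrightarrow> ereal (thickness K * 1)) at_top"
    by (intro tendsto_intros)
  then show "y \<le> ereal (thickness K)"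
    using tendsto_lowerbound[OF _ ev] by simp
qed

theorem proposition10:
  fixes K :: "(real ^ 'n) set"
  assumes "CARD('n) \<ge> 2"
    and "convex_body K"
  shows "thickness K = inf_max_chord K \<and> ereal (inf_max_chord K) = liminf_max_chord K"
proof -
  note le = thickness_le_max_chord[OF assms(2)]
  have "thickness K \<le> inf_max_chord K"
    unfolding inf_max_chord_def by (intro cINF_greatest le) simp
  \<comment> \<open>The thickness bounds all values from below, so the real infimum is a genuine
    one.\<close>
  moreover have "inf_max_chord K \<le> max_chord K p" for p
    unfolding inf_max_chord_def by (intro cINF_lower bdd_belowI2[OF le]) simp
  then have "ereal (inf_max_chord K) \<le> liminf_max_chord K"
    unfolding liminf_max_chord_def by (intro Liminf_bounded always_eventually) simp
  moreover note liminf_max_chord_le[OF assms(2)]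
  \<comment> \<open>The inequalities close a cycle: thickness, infimum, limit inferior,
    thickness.\<close>
  ultimately show ?thesis
    by (metis ereal_less_eq(3) order_antisym order_trans)
qed

end
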